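(* Let $n$ be a positive integer, $x\in\mathbb{B}^n$ and $0<k<1$, and consider the $j^*$-metric sphere $S_{j^*}(x,k)$ in the domain $G=\mathbb{B}^n$. If $x=0$, then $S_{j^*}(x,k)=S^{n-1}(0,2k/(1+k))$. If $x\neq0$, then $$S_{j^*}(x,k)=\left(S^{n-1}\left(x,\frac{2k(1-|x|)}{1-k}\right)\cap\overline{B}^n(0,|x|)\right)\cup\left(S_\Upsilon(x,k)\setminus\overline{B}^n(0,|x|)\right),$$ where $S_\Upsilon(x,k)=\left\{y\in\mathbb{B}^n\setminus\{0\} : \dfrac{|x-y|}{|x-y|+2-2|y|}=k\right\}$.
   Context: $\mathbb{B}^n$ is the open Euclidean unit ball of $\mathbb{R}^n$; $\overline{B}^n(x,r)$ is the closed Euclidean ball and $S^{n-1}(x,r)$ the Euclidean sphere with center $x$ and radius $r$. The $j^*$-metric in $\mathbb{B}^n$ is $j^*_{\mathbb{B}^n}(x,y)=\dfrac{|x-y|}{|x-y|+2\min\{1-|x|,1-|y|\}}$, and $S_{j^*}(x,k)=\{y\in\mathbb{B}^n : j^*_{\mathbb{B}^n}(x,y)=k\}$. *)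

theory Defs
  imports "HOL-Analysis.Analysis"
begin

definition jstar_ball :: "real ^ 'n \<Rightarrow> real ^ 'n \<Rightarrow> real" where
  "jstar_ball x y = norm (x - y) / (norm (x - y) + 2 * min (1 - norm x) (1 - norm y))"

definition jstar_sphere :: "real ^ 'n \<Rightarrow> real \<Rightarrow> (real ^ 'n) set" where
  "jstar_sphere x k = {y \<in> ball 0 1. jstar_ball x y = k}"

definition upsilon_sphere :: "real ^ 'n \<Rightarrow> real \<Rightarrow> (real ^ 'n) set" where
  "upsilon_sphere x k =
    {y \<in> ball 0 1 - {0}. norm (x - y) / (norm (x - y) + 2 - 2 * norm y) = k}"

end

theory Submission
  imports Defs
begin

text \<open>
  The minimum in the \<open>j\<^sup>*\<close>-metric selects the centre or the moving point, whichever has the larger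
  norm, so a sphere is cut into two pieces along the closed ball through its centre. Inside that
  ball the height \<open>1 - |x|\<close> is constant, and a level set of the increasing function
  \<open>d \<mapsto> d / (d + 2h)\<close> of \<open>d = |x - y|\<close> is a Euclidean sphere about \<open>x\<close>
  (\<open>divide_add_twice_eq_iff\<close>). Outside it the defining equation is that of the
  \<open>\<Upsilon>\<close>-sphere. When the centre is the origin, every \<open>y\<close> has the larger norm, and the
  equation involves \<open>|y|\<close> alone.
\<close>

text \<open>
  Clearing the positive denominator leaves an equation linear in \<open>d\<close>, whose leading coefficient
  \<open>1 - k\<close> is nonzero.
\<close>

lemma divide_add_twice_eq_iff:
  fixes d h k :: real
  assumes "0 \<le> d" and "0 < h" and "k < 1"
  shows "d / (d + 2 * h) = k \<longleftrightarrow> d = 2 * k * h / (1 - k)"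
proof -
  have "d / (d + 2 * h) = k \<longleftrightarrow> d = k * (d + 2 * h)"
    using assms by (simp add: divide_eq_eq)
  also have "\<dots> \<longleftrightarrow> d * (1 - k) = 2 * k * h"
    by (auto simp: algebra_simps)
  also have "\<dots> \<longleftrightarrow> d = 2 * k * h / (1 - k)"
    using assms by (simp add: eq_divide_eq)
  finally show ?thesis .
qed

lemma jstar_sphere_zero:
  fixes k :: real
  assumes "0 < k" and "k < 1"
  shows "jstar_sphere (0 :: real ^ 'n) k = sphere 0 (2 * k / (1 + k))"
proof -
  have "y \<in> jstar_sphere 0 k \<longleftrightarrow> y \<in> sphere 0 (2 * k / (1 + k))" for y :: "real ^ 'n"
  proof (cases "norm y < 1")
    case True
    then have "jstar_ball 0 y = k \<longleftrightarrow> norm y = 2 * k * (1 - norm y) / (1 - k)"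
      using divide_add_twice_eq_iff[of "norm y" "1 - norm y" k] assms
      by (simp add: jstar_ball_def min_def)
    also have "\<dots> \<longleftrightarrow> norm y * (1 + k) = 2 * k"
      using assms by (auto simp: eq_divide_eq algebra_simps)
    also have "\<dots> \<longleftrightarrow> norm y = 2 * k / (1 + k)"
      using assms by (simp add: eq_divide_eq)
    finally show ?thesis
      using True by (simp add: jstar_sphere_def)
  next
    case False
    moreover have "2 * k / (1 + k) < 1"
      using assms by simp
    ultimately show ?thesis
      by (auto simp: jstar_sphere_def)
  qed
  then show ?thesis
    by blast
qed

lemma jstar_sphere_eq_sphere_Un_upsilon_sphere:
  fixes x :: "real ^ 'n" and k :: real
  assumes "norm x < 1" and "k < 1"
  shows "jstar_sphere x k =
    (sphere x (2 * k * (1 - norm x) / (1 - k)) \<inter> cball 0 (norm x)) \<union>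
    (upsilon_sphere x k - cball 0 (norm x))"
    (is "_ = ?S")
proof -
  have "y \<in> jstar_sphere x k \<longleftrightarrow> y \<in> ?S" for y
  proof (cases "norm y \<le> norm x")
    case True
    then have "jstar_ball x y = k \<longleftrightarrow> norm (x - y) = 2 * k * (1 - norm x) / (1 - k)"
      using divide_add_twice_eq_iff[of "norm (x - y)" "1 - norm x" k] assms
      by (simp add: jstar_ball_def min_def)
    then show ?thesis
      using True assms by (simp add: jstar_sphere_def dist_norm)
  next
    case False
    then have "jstar_ball x y = norm (x - y) / (norm (x - y) + 2 - 2 * norm y)"
      by (simp add: jstar_ball_def min_def algebra_simps)
    moreover have "y \<noteq> 0"
      using False by auto
    ultimately show ?thesis
      using False by (simp add: jstar_sphere_def upsilon_sphere_def)
  qed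
  then show ?thesis
    by blast
qed

theorem corollary4p4:
  fixes x :: "real ^ 'n" and k :: real
  assumes "x \<in> ball 0 1" and "0 < k" and "k < 1"
  shows "(x = 0 \<longrightarrow> jstar_sphere x k = sphere 0 (2 * k / (1 + k))) \<and>
    (x \<noteq> 0 \<longrightarrow> jstar_sphere x k =
       (sphere x (2 * k * (1 - norm x) / (1 - k)) \<inter> cball 0 (norm x)) \<union>
       (upsilon_sphere x k - cball 0 (norm x)))"
  using assms jstar_sphere_zero[of k, where 'n = 'n]
    jstar_sphere_eq_sphere_Un_upsilon_sphere[of x k] by simp

end
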